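(* Let $D$ be a digraph on the vertex set $[n]$ with positive complexity. Then the numbers of spanning converging trees $c_1,\ldots,c_n$ of $D$ encode the unique linear dependence among the vertices $\mathbf{v}_1,\ldots,\mathbf{v}_n$ of $P_D$ (unique up to scaling), i.e. $$\sum_{i=1}^n c_i\mathbf{v}_i=\mathbf{0}.$$
   Context: A digraph $D$ is a finite directed graph on the vertex set $[n]=\{1,\ldots,n\}$, without loops and without isolated vertices (vertices with indegree and outdegree both zero); multiple directed edges are allowed. A directed edge $(i,j)$ has tail $i$ and head $j$. Let $a_{i,j}$ be the number of edges with tail $i$ and head $j$ (so $a_{i,i}=0$), and let $\mathrm{outdeg}(i)=\sum_j a_{i,j}$. The Laplacian matrix of $D$ is $L(D)=O(D)-A(D)$, where $A(D)=(a_{i,j})$ and $O(D)$ is the diagonal matrix with entries $\mathrm{outdeg}(i)$. The Laplacian polytope of $D$ is $P_D=\operatorname{conv}\{\mathbf{v}_1,\ldots,\mathbf{v}_n\}\subset\mathbb{R}^n$, where $\mathbf{v}_i$ is the $i$-th row of $L(D)$. A converging tree is a digraph whose underlying undirected graph is connected and that has one vertex of outdegree zero (its root), all other vertices having outdegree one. A subgraph of $D$ is spanning if its vertex set is $[n]$. Let $c_i$ be the number of spanning converging trees of $D$ with root $i$ (parallel edges are regarded as distinct). The complexity of $D$ is $c(D)=\sum_{i=1}^n c_i$; $D$ has positive complexity if $c(D)>0$. *)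

theory Defs
  imports "HOL-Analysis.Analysis" "Graph_Theory.Digraph_Component"
begin

text \<open>Parallel arcs are allowed, so the library locale \<open>digraph\<close> (which forbids them) is not used.\<close>

locale multi_digraph = fin_digraph + loopfree_digraph +
  assumes no_isolated: "v \<in> verts G \<Longrightarrow> in_degree G v \<noteq> 0 \<or> out_degree G v \<noteq> 0"

definition arc_mult :: "('a, 'e) pre_digraph \<Rightarrow> 'a \<Rightarrow> 'a \<Rightarrow> nat" where
  "arc_mult D i j = card {e \<in> arcs D. tail D e = i \<and> head D e = j}"

text \<open>The vertex set \<open>[n]\<close> is the index type \<open>'n\<close>; these notions are meant for digraphs with
  \<^term>\<open>verts D = UNIV\<close>.\<close>

definition adjacency_matrix :: "('n::finite, 'e) pre_digraph \<Rightarrow> real^'n^'n" where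
  "adjacency_matrix D = (\<chi> i j. real (arc_mult D i j))"

definition outdeg_matrix :: "('n::finite, 'e) pre_digraph \<Rightarrow> real^'n^'n" where
  "outdeg_matrix D = (\<chi> i j. if i = j then real (out_degree D i) else 0)"

definition laplacian :: "('n::finite, 'e) pre_digraph \<Rightarrow> real^'n^'n" where
  "laplacian D = outdeg_matrix D - adjacency_matrix D"

definition laplacian_polytope :: "('n::finite, 'e) pre_digraph \<Rightarrow> (real^'n) set" where
  "laplacian_polytope D = convex hull (range (\<lambda>i. row i (laplacian D)))"

text \<open>\<^const>\<open>Digraph_Component.connected\<close> is connectedness of the underlying undirected graph; the
  qualifier separates it from topological connectedness.\<close>

definition converging_tree :: "('a, 'e) pre_digraph \<Rightarrow> 'a \<Rightarrow> bool" where
  "converging_tree T r \<longleftrightarrow>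
     fin_digraph T \<and> loopfree_digraph T \<and> Digraph_Component.connected T \<and>
     r \<in> verts T \<and> out_degree T r = 0 \<and> (\<forall>v \<in> verts T - {r}. out_degree T v = 1)"

text \<open>Subgraphs in the library are sets of arcs with inherited \<^const>\<open>tail\<close> and \<^const>\<open>head\<close>, so
  trees using different parallel arcs are counted separately.\<close>

definition num_trees :: "('a, 'e) pre_digraph \<Rightarrow> 'a \<Rightarrow> nat" where
  "num_trees D r = card {T. spanning T D \<and> converging_tree T r}"

definition complexity :: "('a, 'e) pre_digraph \<Rightarrow> nat" where
  "complexity D = (\<Sum>i\<in>verts D. num_trees D i)"

end

theory Submission
  imports Defs
begin

text \<open>The Markov chain tree theorem: adding to a spanning converging tree with root \<open>j\<close> an arc
  leaving \<open>j\<close> gives a choice of one outgoing arc at every vertex, under which every vertex reaches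
  \<open>j\<close>. The same configuration arises from exactly one tree with root \<open>i\<close> and one arc from \<open>i\<close> to
  \<open>j\<close>, where \<open>i\<close> is the predecessor of \<open>j\<close> on the unique cycle. Counting the configurations twice
  gives \<open>c\<^sub>j outdeg(j) = (\<Sum>i. c\<^sub>i a\<^sub>i\<^sub>j)\<close>.

  If \<open>w\<close> satisfies these balance equations, then so does \<open>\<bar>w\<bar>\<close>, since the triangle inequalities
  become equalities when summed over \<open>j\<close>. Hence the support of \<open>w\<close> is closed under arcs and, unless
  empty, contains every root of a spanning converging tree. This makes the dependence unique. A row
  \<open>\<^bold>v\<^sub>i\<close> in the hull of the others has a nonpositive diagonal entry, so it vanishes and \<open>i\<close> is a root,
  which contradicts uniqueness.\<close>

section \<open>Choices of one outgoing arc at every vertex\<close>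

lemma funpow_periodic_pred_unique:
  assumes "(f ^^ a) j = i" "f i = j" "(f ^^ b) j = i'" "f i' = j"
  shows "i = i'"
proof -
  \<comment> \<open>\<open>j\<close> has period \<open>Suc n\<close>, so \<open>k\<close> is also
    the point one step before \<open>Suc n * Suc m\<close>. This exponent is symmetric in
    \<open>n\<close> and \<open>m\<close>, so both predecessors of \<open>j\<close> sit at the same
    position.\<close>
  have pred: "(f ^^ (Suc n * Suc m - 1)) j = k" if "(f ^^ n) j = k" "f k = j" for n m k
  proof -
    have "(f ^^ Suc n) j = j"
      using that by simp
    moreover have "(h ^^ m) j = j" if "h j = j" for h
      using that by (induction m) simp_all
    ultimately have "(f ^^ (Suc n * m)) j = j"
      by (simp only: flip: funpow_mult)
    moreover have "Suc n * Suc m - 1 = n + Suc n * m"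
      by simp
    ultimately show ?thesis
      using that by (simp only: funpow_add o_apply)
  qed
  show ?thesis
    using pred[of a i b] pred[of b i' a] assms by (metis mult.commute)
qed

text \<open>An arc is chosen at \<open>r\<close> too, so \<open>r\<close> itself returns to
  \<open>r\<close>: these are the functional subgraphs whose only cycle passes through
  \<open>r\<close>. There are none if some vertex has no outgoing arc.\<close>

definition rooted_sections :: "('a, 'e) pre_digraph \<Rightarrow> 'a \<Rightarrow> ('a \<Rightarrow> 'e) set" where
  "rooted_sections D r =
     {g. (\<forall>v. g v \<in> out_arcs D v) \<and> (\<forall>v. \<exists>k. ((head D \<circ> g) ^^ k) v = r)}"

text \<open>For a rooted section, leaving out \<open>g r\<close> breaks the only cycle.\<close>

definition section_tree :: "('a, 'e) pre_digraph \<Rightarrow> 'a \<Rightarrow> ('a \<Rightarrow> 'e) \<Rightarrow> ('a, 'e) pre_digraph" where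
  "section_tree D r g = \<lparr>verts = verts D, arcs = g ` (- {r}), tail = tail D, head = head D\<rparr>"

lemma section_tree_simps [simp]:
  "verts (section_tree D r g) = verts D"
  "arcs (section_tree D r g) = g ` (- {r})"
  "tail (section_tree D r g) = tail D"
  "head (section_tree D r g) = head D"
  by (simp_all add: section_tree_def)

text \<open>Makes the union in \<open>rooted_sections_eq_Union\<close> disjoint: \<open>i\<close>
  and \<open>i'\<close> both lie on the orbit of \<open>j\<close> and both map to
  \<open>j\<close>.\<close>

lemma rooted_sections_pred_unique:
  assumes "g \<in> rooted_sections D i" "head D (g i) = j"
    and "g \<in> rooted_sections D i'" "head D (g i') = j"
  shows "i = i'"
proof -
  obtain a b where "((head D \<circ> g) ^^ a) j = i" "((head D \<circ> g) ^^ b) j = i'"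
    using assms unfolding rooted_sections_def by blast
  then show ?thesis
    using assms by (intro funpow_periodic_pred_unique[of a "head D \<circ> g" j i b i']) auto
qed

text \<open>Any vertex of the unique cycle can serve as root, so the root may be moved one step
  forward or backward along the cycle.\<close>

lemma rooted_sections_eq_Union:
  "rooted_sections D j = (\<Union>i. {g \<in> rooted_sections D i. head D (g i) = j})"
proof (intro equalityI subsetI)
  fix g assume g: "g \<in> rooted_sections D j"
  let ?f = "head D \<circ> g"
  obtain k where "(?f ^^ k) (?f j) = j"
    using g unfolding rooted_sections_def by blast
  then have i: "?f ((?f ^^ k) j) = j"
    by (metis funpow_swap1)
  \<comment> \<open>The predecessor of \<open>j\<close> on the cycle; a vertex that reaches
    \<open>j\<close> reaches it after \<open>k\<close> further steps.\<close>
  define i where "i = (?f ^^ k) j"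
  have "\<exists>m. (?f ^^ m) v = i" for v
  proof -
    obtain m where "(?f ^^ m) v = j"
      using g unfolding rooted_sections_def by blast
    then have "(?f ^^ (k + m)) v = i"
      by (simp add: funpow_add i_def)
    then show ?thesis ..
  qed
  then have "g \<in> rooted_sections D i"
    using g unfolding rooted_sections_def by blast
  then show "g \<in> (\<Union>i. {g \<in> rooted_sections D i. head D (g i) = j})"
    using i unfolding i_def by auto
next
  fix g assume "g \<in> (\<Union>i. {g \<in> rooted_sections D i. head D (g i) = j})"
  then obtain i where g: "g \<in> rooted_sections D i" and j: "(head D \<circ> g) i = j"
    by auto
  have "\<exists>m. ((head D \<circ> g) ^^ m) v = j" for v
  proof -
    obtain m where "((head D \<circ> g) ^^ m) v = i"
      using g unfolding rooted_sections_def by blast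
    then have "((head D \<circ> g) ^^ Suc m) v = j"
      using j by simp
    then show ?thesis ..
  qed
  then show "g \<in> rooted_sections D j"
    using g unfolding rooted_sections_def by blast
qed

text \<open>Induction along an undirected walk from \<open>r\<close> to \<open>v\<close>. If the new
  vertex \<open>y\<close> has an arc to \<open>x\<close>, it is prepended to the path. If the arc
  goes from \<open>x\<close> to \<open>y\<close>, it is the only arc leaving \<open>x\<close>, so
  the path from \<open>x\<close> to \<open>r\<close> already passes through
  \<open>y\<close>.\<close>

lemma converging_tree_reachable:
  assumes "converging_tree T r" "v \<in> verts T"
  shows "v \<rightarrow>\<^sup>*\<^bsub>T\<^esub> r"
proof -
  interpret T: fin_digraph T
    using assms by (simp add: converging_tree_def)
  interpret M: pair_wf_digraph "mk_symmetric T"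
    by (rule T.wellformed_mk_symmetric)
  have r: "r \<in> verts T" "out_degree T r = 0"
    using assms by (auto simp: converging_tree_def)
  have "r \<rightarrow>\<^sup>*\<^bsub>with_proj (mk_symmetric T)\<^esub> v"
    using assms r unfolding converging_tree_def Digraph_Component.connected_def
    by (auto elim: strongly_connectedE)
  then show ?thesis
  proof (induction rule: M.reachable_induct)
    case base
    then show ?case using r by simp
  next
    case (step x y)
    have "(x, y) \<in> arcs_ends T \<or> (y, x) \<in> arcs_ends T"
      using step.hyps by (auto simp: parcs_mk_symmetric arcs_ends_conv)
    then show ?case
    proof
      assume "(y, x) \<in> arcs_ends T"
      then show ?thesis using step.IH by (rule T.adj_reachable_trans)
    next
      assume "(x, y) \<in> arcs_ends T"
      then obtain e where e: "e \<in> out_arcs T x" "head T e = y"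
        by (auto simp: arcs_ends_conv)
      have "out_arcs T r = {}"
        using r(2) T.finite_out_arcs[of r] by (simp only: out_degree_def card_0_eq)
      with e have "x \<noteq> r" by auto
      then have "card (out_arcs T x) = 1"
        using assms step.IH by (auto simp: converging_tree_def out_degree_def elim: reachable_in_vertsE)
      then obtain a where "out_arcs T x = {a}"
        by (rule card_1_singletonE)
      with e(1) have out: "out_arcs T x = {e}"
        by (metis singletonD)
      from step.IH show ?thesis
      proof (cases rule: T.converse_reachable_cases)
        case base
        with \<open>x \<noteq> r\<close> show ?thesis by simp
      next
        case (step z)
        then obtain e' where "e' \<in> out_arcs T x" "head T e' = z"
          by (metis reachableE in_out_arcs_conv)
        then have "z = y"
          using out e(2) by (metis singletonD)
        then show ?thesis using step(2) by simp
      qed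
    qed
  qed
qed

section \<open>Spanning converging trees as sections without the arc at the root\<close>

locale UNIV_digraph = fin_digraph D + loopfree_digraph D
  for D :: "('n::finite, 'e) pre_digraph" +
  assumes verts_UNIV: "verts D = UNIV"
begin

lemma section_tree_reachable_iff:
  assumes "\<And>v. g v \<in> out_arcs D v"
  shows "v \<rightarrow>\<^sup>*\<^bsub>section_tree D r g\<^esub> r \<longleftrightarrow> (\<exists>k. ((head D \<circ> g) ^^ k) v = r)"
proof -
  interpret T: wf_digraph "section_tree D r g"
    by unfold_locales (simp_all add: verts_UNIV)
  show ?thesis
  proof
    assume "v \<rightarrow>\<^sup>*\<^bsub>section_tree D r g\<^esub> r"
    then show "\<exists>k. ((head D \<circ> g) ^^ k) v = r"
    proof (induction rule: T.converse_reachable_induct)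
      case base
      show ?case by (rule exI[of _ 0]) simp
    next
      case (step x y)
      have "y = (head D \<circ> g) x"
        using step.hyps assms by (auto simp: arcs_ends_conv)
      moreover obtain k where "((head D \<circ> g) ^^ k) y = r"
        using step.IH ..
      ultimately have "((head D \<circ> g) ^^ Suc k) x = r"
        by (simp add: funpow_Suc_right del: funpow.simps)
      then show ?case ..
    qed
  next
    assume "\<exists>k. ((head D \<circ> g) ^^ k) v = r"
    then obtain k where "((head D \<circ> g) ^^ k) v = r" ..
    then show "v \<rightarrow>\<^sup>*\<^bsub>section_tree D r g\<^esub> r"
    proof (induction k arbitrary: v)
      case 0
      then show ?case by (simp add: verts_UNIV)
    next
      case (Suc k)
      then have reach: "(head D \<circ> g) v \<rightarrow>\<^sup>*\<^bsub>section_tree D r g\<^esub> r"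
        by (simp add: funpow_Suc_right del: funpow.simps)
      show ?case
      \<comment> \<open>The arc \<open>g r\<close> is not in the tree, but \<open>r\<close> reaches
        itself trivially.\<close>
      proof (cases "v = r")
        case False
        then have "(v, (head D \<circ> g) v) \<in> arcs_ends (section_tree D r g)"
          using assms[of v] by (force simp: arcs_ends_conv)
        then show ?thesis using reach by (rule T.adj_reachable_trans)
      qed (simp add: verts_UNIV)
    qed
  qed
qed

lemma out_arcs_section_tree:
  assumes "\<And>v. g v \<in> out_arcs D v"
  shows "out_arcs (section_tree D r g) v = (if v = r then {} else {g v})"
  using assms by auto

lemma spanning_section_tree:
  assumes "\<And>v. g v \<in> out_arcs D v"
  shows "spanning (section_tree D r g) D"
  using assms wf_digraph by (auto simp: spanning_def subgraph_def compatible_def wf_digraph_def verts_UNIV)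

lemma converging_tree_section_tree:
  assumes g: "g \<in> rooted_sections D r"
  shows "converging_tree (section_tree D r g) r"
proof -
  let ?T = "section_tree D r g"
  have out: "\<And>v. g v \<in> out_arcs D v"
    using g by (simp add: rooted_sections_def)
  interpret T: fin_digraph ?T
    by unfold_locales (simp_all add: verts_UNIV)
  interpret T: loopfree_digraph ?T
    using out by unfold_locales (auto dest: no_loops)
  interpret M: pair_wf_digraph "mk_symmetric ?T"
    by (rule T.wellformed_mk_symmetric)
  have "v \<rightarrow>\<^sup>*\<^bsub>?T\<^esub> r" for v
    using g section_tree_reachable_iff[OF out] by (auto simp: rooted_sections_def)
  then have to_r: "v \<rightarrow>\<^sup>*\<^bsub>with_proj (mk_symmetric ?T)\<^esub> r" for v
    by (intro T.reachable_mk_symmetricI)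
  \<comment> \<open>Any two vertices are joined through \<open>r\<close>.\<close>
  have "u \<rightarrow>\<^sup>*\<^bsub>with_proj (mk_symmetric ?T)\<^esub> v" for u v
    using to_r[of u] symmetric_reachable[OF symmetric_mk_symmetric to_r, of v]
    by (rule M.reachable_trans)
  then have "Digraph_Component.connected ?T"
    by (simp add: Digraph_Component.connected_def strongly_connected_def verts_UNIV)
  moreover have "out_degree ?T v = (if v = r then 0 else 1)" for v
    by (simp add: out_degree_def out_arcs_section_tree[OF out])
  ultimately show ?thesis
    by (simp add: converging_tree_def T.fin_digraph_axioms T.loopfree_digraph_axioms verts_UNIV)
qed

text \<open>A section splits into its tree and its arc at \<open>r\<close>, which can be chosen
  independently. The set \<open>E\<close> serves both counts: all arcs leaving the root, or only
  those with a given head.\<close>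

lemma bij_betw_rooted_sections:
  assumes E: "E \<subseteq> out_arcs D r"
  shows "bij_betw (\<lambda>g. (section_tree D r g, g r)) {g \<in> rooted_sections D r. g r \<in> E}
    ({T. spanning T D \<and> converging_tree T r} \<times> E)"
  (is "bij_betw ?F ?U ?TE")
proof (rule bij_betw_imageI)
  show "inj_on ?F ?U"
  proof (rule inj_onI, rule ext)
    fix g h v
    assume g: "g \<in> ?U" and h: "h \<in> ?U" and eq: "?F g = ?F h"
    have out: "out_arcs (section_tree D r g) v = out_arcs (section_tree D r h) v"
      using eq by simp
    show "g v = h v"
    proof (cases "v = r")
      case False
      then show ?thesis
        using out g h
        unfolding rooted_sections_def by (simp add: out_arcs_section_tree del: in_out_arcs_conv)
    qed (use eq in simp)
  qed
  show "?F ` ?U = ?TE"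
  proof (intro equalityI subsetI)
    fix p assume "p \<in> ?F ` ?U"
    then show "p \<in> ?TE"
      using converging_tree_section_tree spanning_section_tree by (auto simp: rooted_sections_def)
  next
    fix p assume "p \<in> ?TE"
    then obtain T e where p: "p = (T, e)" and T: "spanning T D" "converging_tree T r" and e: "e \<in> E"
      by auto
    have verts: "verts T = UNIV" and arcs: "arcs T \<subseteq> arcs D"
      and tail: "tail T = tail D" and head: "head T = head D"
      using T verts_UNIV by (auto simp: spanning_def subgraph_def compatible_def)
    interpret T: fin_digraph T
      using T by (simp add: converging_tree_def)
    have "\<exists>e. out_arcs T v = {e}" if "v \<noteq> r" for v
      using T that by (auto simp: converging_tree_def verts out_degree_def card_1_singleton_iff)
    then obtain h where h: "\<And>v. v \<noteq> r \<Longrightarrow> out_arcs T v = {h v}"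
      by metis
    have r: "out_arcs T r = {}"
    proof -
      have "card (out_arcs T r) = 0"
        using T(2) unfolding converging_tree_def out_degree_def by blast
      then show ?thesis
        by (simp only: card_0_eq[OF T.finite_out_arcs])
    qed
    \<comment> \<open>The unique outgoing arcs of the tree, completed by \<open>e\<close> at the
      root.\<close>
    define g where "g = h(r := e)"
    have hT: "h v \<in> out_arcs T v" if "v \<noteq> r" for v
      using h[OF that] by simp
    have g: "g v \<in> out_arcs D v" for v
      using hT[of v] e E arcs tail by (auto simp: g_def)
    have "arcs T = g ` (- {r})"
    proof (intro equalityI subsetI)
      fix a assume a: "a \<in> arcs T"
      then have "tail T a \<noteq> r" using r by auto
      moreover have "a \<in> out_arcs T (tail T a)" using a by simp
      ultimately have "a = g (tail T a)"
        using h by (auto simp: g_def)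
      then show "a \<in> g ` (- {r})" using \<open>tail T a \<noteq> r\<close> by blast
    qed (use hT in \<open>auto simp: g_def\<close>)
    then have T_eq: "T = section_tree D r g"
      using verts tail head verts_UNIV by (intro pre_digraph.equality) auto
    have "\<exists>k. ((head D \<circ> g) ^^ k) v = r" for v
      using converging_tree_reachable[OF T(2), of v] verts
      by (simp add: T_eq section_tree_reachable_iff[OF g])
    then have "g \<in> ?U"
      using g e by (simp add: rooted_sections_def g_def)
    moreover have "p = ?F g"
      using p T_eq by (simp add: g_def)
    ultimately show "p \<in> ?F ` ?U" by blast
  qed
qed

lemma card_rooted_sections:
  assumes "E \<subseteq> out_arcs D r"
  shows "card {g \<in> rooted_sections D r. g r \<in> E} = num_trees D r * card E"
  using bij_betw_same_card[OF bij_betw_rooted_sections[OF assms]]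
  by (simp add: num_trees_def card_cartesian_product)

lemma finite_rooted_sections: "finite (rooted_sections D r)"
proof (rule finite_subset)
  show "rooted_sections D r \<subseteq> PiE UNIV (\<lambda>_. arcs D)"
    by (auto simp: rooted_sections_def)
  show "finite (PiE (UNIV :: 'n set) (\<lambda>_. arcs D))"
    by (intro finite_PiE) auto
qed

section \<open>Balance equations and dependences among the Laplacian rows\<close>

lemma arc_mult_eq: "arc_mult D i j = card {e \<in> out_arcs D i. head D e = j}"
  by (simp add: arc_mult_def conj_assoc)

lemma num_trees_balance:
  "num_trees D j * out_degree D j = (\<Sum>i\<in>UNIV. num_trees D i * arc_mult D i j)"
proof -
  have "num_trees D j * out_degree D j = card {g \<in> rooted_sections D j. g j \<in> out_arcs D j}"
    by (simp only: card_rooted_sections[OF order_refl] out_degree_def)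
  also have "{g \<in> rooted_sections D j. g j \<in> out_arcs D j} = rooted_sections D j"
    by (auto simp: rooted_sections_def)
  \<comment> \<open>The second count sorts the same sections by the predecessor \<open>i\<close> of
    \<open>j\<close> on the cycle.\<close>
  also have "card \<dots> = (\<Sum>i\<in>UNIV. card {g \<in> rooted_sections D i. head D (g i) = j})"
    unfolding rooted_sections_eq_Union[of D j]
  proof (rule card_UN_disjoint)
    show "\<forall>i\<in>UNIV. \<forall>i'\<in>UNIV. i \<noteq> i' \<longrightarrow> {g \<in> rooted_sections D i. head D (g i) = j} \<inter>
        {g \<in> rooted_sections D i'. head D (g i') = j} = {}"
      using rooted_sections_pred_unique by fast
  qed (simp_all add: finite_rooted_sections)
  also have "\<dots> = (\<Sum>i\<in>UNIV. num_trees D i * arc_mult D i j)"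
  proof (rule sum.cong[OF refl])
    fix i
    have "{g \<in> rooted_sections D i. head D (g i) = j} =
        {g \<in> rooted_sections D i. g i \<in> {e \<in> out_arcs D i. head D e = j}}"
      by (auto simp: rooted_sections_def)
    moreover have "{e \<in> out_arcs D i. head D e = j} \<subseteq> out_arcs D i"
      by blast
    ultimately show "card {g \<in> rooted_sections D i. head D (g i) = j} = num_trees D i * arc_mult D i j"
      by (simp only: arc_mult_eq card_rooted_sections)
  qed
  finally show ?thesis .
qed

lemma out_degree_eq_sum: "out_degree D i = (\<Sum>j\<in>UNIV. arc_mult D i j)"
proof -
  have "out_arcs D i = (\<Union>j. {e \<in> out_arcs D i. head D e = j})"
    by auto
  then have "out_degree D i = card (\<Union>j. {e \<in> out_arcs D i. head D e = j})"
    unfolding out_degree_def by (rule arg_cong)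
  also have "\<dots> = (\<Sum>j\<in>UNIV. arc_mult D i j)"
    unfolding arc_mult_eq by (rule card_UN_disjoint) auto
  finally show ?thesis .
qed

lemma laplacian_nth:
  "laplacian D $ i $ j = (if i = j then real (out_degree D j) else 0) - real (arc_mult D i j)"
  by (simp add: laplacian_def outdeg_matrix_def adjacency_matrix_def)

lemma arc_mult_self [simp]: "arc_mult D i i = 0"
proof -
  have "{e \<in> arcs D. tail D e = i \<and> head D e = i} = {}"
    by (simp only: Collect_empty_eq) (metis no_loops)
  then show ?thesis by (simp only: arc_mult_def card.empty)
qed

text \<open>Coordinate \<open>j\<close> pairs \<open>w\<close> with column \<open>j\<close> of the
  Laplacian: the diagonal gives the outflow at \<open>j\<close>, the other entries the
  inflow.\<close>

lemma dependence_iff_balance: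
  "(\<Sum>i\<in>UNIV. w i *\<^sub>R row i (laplacian D)) = 0 \<longleftrightarrow>
    (\<forall>j. w j * real (out_degree D j) = (\<Sum>i\<in>UNIV. w i * real (arc_mult D i j)))"
proof -
  have "(\<Sum>i\<in>UNIV. w i * (if i = j then x else 0)) = w j * x" for j x
    by (simp add: if_distrib cong: if_cong)
  then have "(\<Sum>i\<in>UNIV. w i *\<^sub>R row i (laplacian D)) $ j =
      w j * real (out_degree D j) - (\<Sum>i\<in>UNIV. w i * real (arc_mult D i j))" for j
    by (simp add: row_def laplacian_nth right_diff_distrib sum_subtractf)
  then show ?thesis
    by (simp add: vec_eq_iff)
qed

lemma num_trees_dependence: "(\<Sum>i\<in>UNIV. real (num_trees D i) *\<^sub>R row i (laplacian D)) = 0"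
  unfolding dependence_iff_balance
  using num_trees_balance by (metis (mono_tags, lifting) of_nat_mult of_nat_sum sum.cong)

section \<open>Uniqueness of the dependence\<close>

lemma balance_support_closed:
  assumes bal: "\<And>j. w j * real (out_degree D j) = (\<Sum>i\<in>UNIV. w i * real (arc_mult D i j))"
    and "w i \<noteq> 0" "(i, j) \<in> arcs_ends D"
  shows "w j \<noteq> 0"
proof -
  \<comment> \<open>The inflow at \<open>j\<close> for the absolute values of
    \<open>w\<close>.\<close>
  define s where "s j = (\<Sum>i\<in>UNIV. \<bar>w i\<bar> * real (arc_mult D i j))" for j
  have le: "\<bar>w j\<bar> * real (out_degree D j) \<le> s j" for j
  proof -
    have "\<bar>w j\<bar> * real (out_degree D j) = \<bar>\<Sum>i\<in>UNIV. w i * real (arc_mult D i j)\<bar>"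
      by (simp add: abs_mult flip: bal)
    also have "\<dots> \<le> s j"
      unfolding s_def by (rule order_trans[OF sum_abs]) (simp add: abs_mult)
    finally show ?thesis .
  qed
  \<comment> \<open>Every arc is counted once at its tail and once at its head, so total inflow
    equals total outflow. The nonnegative differences from \<open>le\<close> therefore all
    vanish.\<close>
  have "(\<Sum>j\<in>UNIV. s j) = (\<Sum>i\<in>UNIV. \<bar>w i\<bar> * real (out_degree D i))"
    unfolding s_def out_degree_eq_sum by (subst sum.swap) (simp add: sum_distrib_left)
  then have "(\<Sum>j\<in>UNIV. s j - \<bar>w j\<bar> * real (out_degree D j)) = 0"
    by (simp add: sum_subtractf)
  then have eq: "s j = \<bar>w j\<bar> * real (out_degree D j)"
    using le by (subst (asm) sum_nonneg_eq_0_iff) auto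
  have "arc_mult D i j > 0"
    using assms(3) by (auto simp: arc_mult_def arcs_ends_conv card_gt_0_iff)
  then have "0 < \<bar>w i\<bar> * real (arc_mult D i j)"
    using assms(2) by simp
  also have "\<dots> \<le> s j"
    unfolding s_def by (rule member_le_sum) auto
  finally show ?thesis
    using eq by auto
qed

text \<open>A nonzero \<open>w i\<close> would propagate along the path from \<open>i\<close> to
  \<open>r\<close> in a spanning converging tree.\<close>

lemma balance_eq_0:
  assumes bal: "\<And>j. w j * real (out_degree D j) = (\<Sum>i\<in>UNIV. w i * real (arc_mult D i j))"
    and "num_trees D r > 0" "w r = 0"
  shows "w i = 0"
proof (rule ccontr)
  assume "w i \<noteq> 0"
  obtain T where T: "spanning T D" "converging_tree T r"
    using assms(2) unfolding num_trees_def by (auto simp: card_gt_0_iff)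
  then have sub: "arcs_ends T \<subseteq> arcs_ends D" and verts: "verts T = UNIV"
    using verts_UNIV by (auto simp: spanning_def subgraph_def compatible_def arcs_ends_conv)
  interpret T: wf_digraph T
    using T by (auto simp: spanning_def subgraph_def)
  have "i \<rightarrow>\<^sup>*\<^bsub>T\<^esub> r"
    using converging_tree_reachable[OF T(2)] verts by simp
  then have "w r \<noteq> 0"
  proof (induction rule: T.reachable_induct)
    case (step x y)
    then show ?case using balance_support_closed[OF bal] sub by blast
  qed (use \<open>w i \<noteq> 0\<close> in simp)
  with assms(3) show False by simp
qed

lemma dependence_unique:
  assumes "num_trees D r > 0" "(\<Sum>i\<in>UNIV. w i *\<^sub>R row i (laplacian D)) = 0"
  shows "w i = w r / real (num_trees D r) * real (num_trees D i)"
proof -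
  \<comment> \<open>The multiple of the tree counts is chosen to cancel \<open>w\<close> at
    \<open>r\<close>, so that \<open>balance_eq_0\<close> applies to the difference.\<close>
  define w' where "w' i = w i - w r / real (num_trees D r) * real (num_trees D i)" for i
  have "(\<Sum>i\<in>UNIV. w' i *\<^sub>R row i (laplacian D)) =
      (\<Sum>i\<in>UNIV. w i *\<^sub>R row i (laplacian D)) -
      (w r / real (num_trees D r)) *\<^sub>R (\<Sum>i\<in>UNIV. real (num_trees D i) *\<^sub>R row i (laplacian D))"
    by (simp add: w'_def scaleR_diff_left sum_subtractf scaleR_sum_right)
  also have "\<dots> = 0"
    by (simp add: assms(2) num_trees_dependence)
  finally have "(\<Sum>i\<in>UNIV. w' i *\<^sub>R row i (laplacian D)) = 0" .
  note bal = this[unfolded dependence_iff_balance, rule_format]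
  have "w' r = 0"
    using assms(1) by (simp add: w'_def)
  with bal assms(1) have "w' i = 0"
    by (rule balance_eq_0)
  then show ?thesis by (simp add: w'_def)
qed

section \<open>The rows as the vertices of the polytope\<close>

lemma num_trees_eq_0:
  assumes "out_degree D i = 0" "i \<noteq> r"
  shows "num_trees D r = 0"
proof -
  have "\<not> (spanning T D \<and> converging_tree T r)" for T
  proof
    assume T: "spanning T D \<and> converging_tree T r"
    then have "out_arcs T i \<subseteq> out_arcs D i" "i \<in> verts T"
      using verts_UNIV by (auto simp: spanning_def subgraph_def compatible_def)
    moreover have "out_arcs D i = {}"
      using assms finite_out_arcs[of i] by (simp only: out_degree_def card_0_eq)
    ultimately have "out_degree T i = 0"
      by (simp add: out_degree_def)
    moreover have "out_degree T i = 1"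
      using T assms(2) \<open>i \<in> verts T\<close> by (simp add: converging_tree_def)
    ultimately show False by simp
  qed
  then have "{T. spanning T D \<and> converging_tree T r} = {}"
    by blast
  then show ?thesis by (simp only: num_trees_def card.empty)
qed

text \<open>The weights are indexed by vertices rather than by points, so the lemma applies before
  the rows are known to be distinct. It yields both their distinctness and their
  extremality.\<close>

lemma row_not_convex_combination:
  assumes "num_trees D r > 0"
    and u: "\<And>j. u j \<ge> 0" "u i = 0" "(\<Sum>j\<in>UNIV. u j) = 1"
  shows "(\<Sum>j\<in>UNIV. u j *\<^sub>R row j (laplacian D)) \<noteq> row i (laplacian D)"
proof
  assume eq: "(\<Sum>j\<in>UNIV. u j *\<^sub>R row j (laplacian D)) = row i (laplacian D)"
  \<comment> \<open>Only the diagonal entry of column \<open>i\<close> can be positive, and its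
    weight \<open>u i\<close> is zero.\<close>
  have "u j * laplacian D $ j $ i \<le> 0" for j
    using u by (cases "j = i") (simp_all add: laplacian_nth mult_nonneg_nonpos)
  then have "(\<Sum>j\<in>UNIV. u j * laplacian D $ j $ i) \<le> 0"
    by (simp add: sum_nonpos)
  also have "(\<Sum>j\<in>UNIV. u j * laplacian D $ j $ i) = laplacian D $ i $ i"
    using arg_cong[OF eq, of "\<lambda>x. x $ i"] by (simp add: row_def)
  finally have out: "out_degree D i = 0"
    by (simp add: laplacian_nth)
  then have "arc_mult D i j = 0" for j
    by (simp add: out_degree_eq_sum)
  then have "row i (laplacian D) = 0"
    using out by (simp add: vec_eq_iff row_def laplacian_nth)
  \<comment> \<open>Since row \<open>i\<close> vanishes, \<open>u\<close> is itself a
    dependence.\<close>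
  then have "u j = u r / real (num_trees D r) * real (num_trees D j)" for j
    by (intro dependence_unique[OF assms(1)]) (simp only: eq)
  \<comment> \<open>A vertex without outgoing arcs must be the root of every spanning converging
    tree. Hence \<open>u r = u i = 0\<close>, and the scaling factor is zero.\<close>
  moreover have "r = i"
  proof (rule ccontr)
    assume "r \<noteq> i"
    then have "num_trees D r = 0"
      by (intro num_trees_eq_0[OF out]) simp
    with assms(1) show False by simp
  qed
  ultimately have "u j = 0" for j
    using u(2) by (metis div_0 mult_zero_left)
  then show False using u(3) by simp
qed

lemma inj_row_laplacian:
  assumes "num_trees D r > 0"
  shows "inj (\<lambda>i. row i (laplacian D))"
proof (rule injI, rule ccontr)
  fix i j
  assume eq: "row i (laplacian D) = row j (laplacian D)" and "i \<noteq> j"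
  \<comment> \<open>If the rows were equal, all weight on \<open>j\<close> would give row
    \<open>i\<close>.\<close>
  define u :: "'n \<Rightarrow> real" where "u k = (if k = j then 1 else 0)" for k
  have "(\<Sum>k\<in>UNIV. u k *\<^sub>R row k (laplacian D)) = (\<Sum>k\<in>{j}. row k (laplacian D))"
    by (rule sum.mono_neutral_cong_right) (auto simp: u_def)
  moreover have "(\<Sum>k\<in>UNIV. u k *\<^sub>R row k (laplacian D)) \<noteq> row i (laplacian D)"
    by (rule row_not_convex_combination[OF assms]) (use \<open>i \<noteq> j\<close> in \<open>simp_all add: u_def\<close>)
  ultimately show False
    using eq by simp
qed

lemma row_not_in_hull:
  assumes "num_trees D r > 0"
  shows "row i (laplacian D) \<notin> convex hull (range (\<lambda>i. row i (laplacian D)) - {row i (laplacian D)})"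
proof
  let ?v = "\<lambda>i. row i (laplacian D)"
  have inj: "inj ?v"
    by (rule inj_row_laplacian[OF assms])
  \<comment> \<open>By injectivity, deleting the point removes the index \<open>i\<close>
    alone.\<close>
  have "range ?v - {?v i} = ?v ` (- {i})"
    by (simp add: Compl_eq_Diff_UNIV image_set_diff[OF inj])
  moreover assume "?v i \<in> convex hull (range ?v - {?v i})"
  ultimately obtain u where u: "\<forall>x\<in>?v ` (- {i}). 0 \<le> u x" "sum u (?v ` (- {i})) = 1"
    "(\<Sum>x\<in>?v ` (- {i}). u x *\<^sub>R x) = ?v i"
    by (auto simp: convex_hull_finite)
  \<comment> \<open>Carries the weights from points back to indices, with the value 0 at
    \<open>i\<close> that \<open>row_not_convex_combination\<close> demands.\<close>
  define u' where "u' j = (if j = i then 0 else u (?v j))" for j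
  have inj': "inj_on ?v (- {i})"
    using inj by (rule inj_on_subset) simp
  have "(\<Sum>j\<in>UNIV. u' j) = (\<Sum>j\<in>- {i}. u (?v j))"
    by (rule sum.mono_neutral_cong_right) (auto simp: u'_def)
  then have sum1: "(\<Sum>j\<in>UNIV. u' j) = 1"
    using u(2) by (simp add: sum.reindex[OF inj'])
  have "(\<Sum>j\<in>UNIV. u' j *\<^sub>R ?v j) = (\<Sum>j\<in>- {i}. u (?v j) *\<^sub>R ?v j)"
    by (rule sum.mono_neutral_cong_right) (auto simp: u'_def)
  then have comb: "(\<Sum>j\<in>UNIV. u' j *\<^sub>R ?v j) = ?v i"
    using u(3) by (simp add: sum.reindex[OF inj'])
  have "u' j \<ge> 0" for j
    using u(1) by (simp add: u'_def)
  from row_not_convex_combination[of r u' i, OF assms this _ sum1] comb show False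
    by (simp add: u'_def)
qed

end

theorem proposition5:
  fixes D :: "('n::finite, 'e) pre_digraph"
  assumes "multi_digraph D"
    and "verts D = UNIV"
    and "complexity D > 0"
  shows "bij_betw (\<lambda>i. row i (laplacian D)) UNIV {x. x extreme_point_of laplacian_polytope D} \<and>
    (\<Sum>i\<in>UNIV. real (num_trees D i) *\<^sub>R row i (laplacian D)) = 0 \<and>
    (\<forall>w :: 'n \<Rightarrow> real. (\<Sum>i\<in>UNIV. w i *\<^sub>R row i (laplacian D)) = 0 \<longrightarrow>
       (\<exists>t. \<forall>i. w i = t * real (num_trees D i)))"
proof -
  interpret multi_digraph D by fact
  interpret UNIV_digraph D by unfold_locales fact
  obtain r where r: "num_trees D r > 0"
    using assms(3) unfolding complexity_def
    by (elim gr_implies_not0[THEN sum.not_neutral_contains_not_neutral]) simp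
  let ?S = "range (\<lambda>i. row i (laplacian D))"
  \<comment> \<open>In a compact generating set where no point lies in the hull of the others, the
    generators are exactly the extreme points of the hull.\<close>
  have "x extreme_point_of laplacian_polytope D \<longleftrightarrow> x \<in> ?S" for x
    unfolding laplacian_polytope_def
  proof (rule extreme_point_of_convex_hull_convex_independent)
    show "compact ?S"
      by (simp add: finite_imp_compact)
    show "a \<notin> convex hull (?S - {a})" if "a \<in> ?S" for a
      using that row_not_in_hull[OF r] by (elim rangeE) simp
  qed
  then have "{x. x extreme_point_of laplacian_polytope D} = ?S"
    by simp
  then have "bij_betw (\<lambda>i. row i (laplacian D)) UNIV {x. x extreme_point_of laplacian_polytope D}"
    using inj_row_laplacian[OF r] by (simp add: bij_betw_def)
  moreover have "\<exists>t. \<forall>i. w i = t * real (num_trees D i)"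
    if "(\<Sum>i\<in>UNIV. w i *\<^sub>R row i (laplacian D)) = 0" for w
    using dependence_unique[OF r that] by (intro exI allI)
  ultimately show ?thesis
    by (intro conjI allI impI num_trees_dependence)
qed

end
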